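(* Let $n\geq 2$, let $\eta\colon[0,1]^n\to\mathbb R$ be a $\mathbb Z$-map that is not constant on the boundary of $[0,1]^n$, and let $z\in\mathbb Z$. Then there are $\mathbb Z$-maps $\theta\colon[0,1]^n\to\mathbb R$ and $\alpha\colon[0,1]^n\to[0,1]^n$ such that $z$ belongs to the image of $\theta$ and $\theta\circ\alpha=\eta$.
   Context: A $\mathbb Z$-map $\mathbb R^m\to\mathbb R^n$ is a continuous function that agrees at each point with one of finitely many affine maps with integer coefficients; a $\mathbb Z$-map $A\to B$ ($A\subseteq\mathbb R^m$, $B\subseteq\mathbb R^n$) is a restriction to $A$ of such a map with values in $B$. *)

theory Defs
  imports "HOL-Analysis.Analysis"
begin

text \<open>
  Coefficients are taken with respect to \<open>Basis\<close>, which is the standard basis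
  on \<open>real ^ 'n\<close> and \<open>{1}\<close> on \<open>real\<close>; this covers both kinds of codomain at once.
\<close>

definition integer_affine :: "('a::euclidean_space \<Rightarrow> 'b::euclidean_space) \<Rightarrow> bool" where
  "integer_affine f \<longleftrightarrow>
     (\<exists>(A :: 'b \<Rightarrow> 'a \<Rightarrow> int) (c :: 'b \<Rightarrow> int). \<forall>x. \<forall>i\<in>Basis.
        f x \<bullet> i = (\<Sum>j\<in>Basis. of_int (A i j) * (x \<bullet> j)) + of_int (c i))"

definition Z_map :: "('a::euclidean_space \<Rightarrow> 'b::euclidean_space) \<Rightarrow> bool" where
  "Z_map g \<longleftrightarrow> continuous_on UNIV g \<and>
     (\<exists>F. finite F \<and> (\<forall>f\<in>F. integer_affine f) \<and> (\<forall>x. \<exists>f\<in>F. g x = f x))"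

text \<open>
  Only the values of \<open>f\<close> on \<open>A\<close> matter: a map \<open>A \<rightarrow> B\<close> is represented by a total function.
\<close>

definition Z_map_on ::
    "'a::euclidean_space set \<Rightarrow> 'b::euclidean_space set \<Rightarrow> ('a \<Rightarrow> 'b) \<Rightarrow> bool" where
  "Z_map_on A B f \<longleftrightarrow> (\<exists>g. Z_map g \<and> (\<forall>x\<in>A. f x = g x)) \<and> f ` A \<subseteq> B"

abbreviation unit_cube :: "(real ^ 'n) set" where
  "unit_cube \<equiv> cbox 0 1"

end

theory Submission imports Defs begin

text \<open>
  Since \<open>\<eta>\<close> is not constant on the boundary, it is not constant on some facet. Let \<open>n\<close> be the
  inward normal of that facet. At a generic point of the facet \<open>\<eta>\<close> agrees, on the side of the
  cube, with a single affine map \<open>x \<mapsto> a \<bullet> x + d\<close> whose gradient \<open>a\<close> is not parallel to \<open>n\<close>. Hence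
  some integer vector \<open>v\<close> is orthogonal to \<open>a\<close> and points into the cube. Let \<open>t \<ge> 0\<close> be a small
  \<open>\<int>\<close>-map, nonzero only near that point of the facet, such that the shift \<open>\<alpha> x = x + t x v\<close>
  leaves the support of \<open>t\<close>, that is \<open>t \<circ> \<alpha> = 0\<close>. Then \<open>\<eta> \<circ> \<alpha> = \<eta>\<close>, so \<open>\<theta> = \<eta> + K t\<close> satisfies
  \<open>\<theta> \<circ> \<alpha> = \<eta>\<close> for every integer \<open>K\<close>; for a suitable \<open>K\<close> the value \<open>z\<close> is attained because the
  cube is connected.
\<close>

section \<open>Integer affine functions\<close>

definition integral_vector :: "'a::euclidean_space \<Rightarrow> bool" where
  "integral_vector v \<longleftrightarrow> (\<forall>b\<in>Basis. v \<bullet> b \<in> \<int>)"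

lemma integral_vector_real_iff [simp]: "integral_vector (x :: real) \<longleftrightarrow> x \<in> \<int>"
  by (simp add: integral_vector_def)

lemma integral_vector_Basis: "b \<in> Basis \<Longrightarrow> integral_vector b"
  by (simp add: integral_vector_def inner_Basis)

lemma integral_vector_add: "integral_vector u \<Longrightarrow> integral_vector v \<Longrightarrow> integral_vector (u + v)"
  by (simp add: integral_vector_def inner_add_left)

lemma integral_vector_diff: "integral_vector u \<Longrightarrow> integral_vector v \<Longrightarrow> integral_vector (u - v)"
  by (simp add: integral_vector_def inner_diff_left)

lemma integral_vector_scaleR: "m \<in> \<int> \<Longrightarrow> integral_vector v \<Longrightarrow> integral_vector (m *\<^sub>R v)"
  by (simp add: integral_vector_def)

lemma integral_vector_inner: "integral_vector u \<Longrightarrow> integral_vector v \<Longrightarrow> u \<bullet> v \<in> \<int>"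
  by (subst euclidean_inner) (auto simp: integral_vector_def intro!: Ints_sum Ints_mult)

lemma integer_affine_iff:
  "integer_affine f \<longleftrightarrow>
     (\<forall>i\<in>Basis. \<exists>a d. integral_vector a \<and> d \<in> \<int> \<and> (\<forall>x. f x \<bullet> i = a \<bullet> x + d))"
proof
  assume "integer_affine f"
  then obtain A c where f: "\<And>x i. i \<in> Basis \<Longrightarrow>
      f x \<bullet> i = (\<Sum>j\<in>Basis. of_int (A i j) * (x \<bullet> j)) + of_int (c i)"
    unfolding integer_affine_def by blast
  show "\<forall>i\<in>Basis. \<exists>a d. integral_vector a \<and> d \<in> \<int> \<and> (\<forall>x. f x \<bullet> i = a \<bullet> x + d)"
  proof
    fix i :: 'b assume "i \<in> Basis"
    define a where "a = (\<Sum>j\<in>Basis. of_int (A i j) *\<^sub>R j)"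
    have "integral_vector a"
      by (simp add: a_def integral_vector_def)
    moreover have "f x \<bullet> i = a \<bullet> x + of_int (c i)" for x
      using f[OF \<open>i \<in> Basis\<close>] by (simp add: a_def inner_sum_right inner_commute[of _ x])
    ultimately show "\<exists>a d. integral_vector a \<and> d \<in> \<int> \<and> (\<forall>x. f x \<bullet> i = a \<bullet> x + d)"
      by (intro exI[of _ a] exI[of _ "of_int (c i)"]) simp
  qed
next
  assume "\<forall>i\<in>Basis. \<exists>a d. integral_vector a \<and> d \<in> \<int> \<and> (\<forall>x. f x \<bullet> i = a \<bullet> x + d)"
  then obtain a d where ad: "\<And>i. i \<in> Basis \<Longrightarrow> integral_vector (a i)" "\<And>i. i \<in> Basis \<Longrightarrow> d i \<in> \<int>"
      and f: "\<And>i x. i \<in> Basis \<Longrightarrow> f x \<bullet> i = a i \<bullet> x + d i"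
    by metis
  have "f x \<bullet> i = (\<Sum>j\<in>Basis. of_int \<lfloor>a i \<bullet> j\<rfloor> * (x \<bullet> j)) + of_int \<lfloor>d i\<rfloor>" if "i \<in> Basis" for x i
    using that ad by (subst f, simp, subst euclidean_inner) (simp add: integral_vector_def)
  then show "integer_affine f"
    unfolding integer_affine_def
    by (intro exI[of _ "\<lambda>i j. \<lfloor>a i \<bullet> j\<rfloor>"] exI[of _ "\<lambda>i. \<lfloor>d i\<rfloor>"]) blast
qed

lemma integer_affine_real_iff:
  fixes f :: "'a::euclidean_space \<Rightarrow> real"
  shows "integer_affine f \<longleftrightarrow> (\<exists>a d. integral_vector a \<and> d \<in> \<int> \<and> (\<forall>x. f x = a \<bullet> x + d))"
  by (simp add: integer_affine_iff)

lemma integer_affine_id: "integer_affine (\<lambda>x. x)"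
  unfolding integer_affine_iff
proof
  fix i :: 'a assume "i \<in> Basis"
  then show "\<exists>a d. integral_vector a \<and> d \<in> \<int> \<and> (\<forall>x. x \<bullet> i = a \<bullet> x + d)"
    by (intro exI[of _ i] exI[of _ 0]) (simp add: integral_vector_Basis inner_commute)
qed

lemma integer_affine_add:
  assumes "integer_affine f" "integer_affine g"
  shows "integer_affine (\<lambda>x. f x + g x)"
  unfolding integer_affine_iff
proof
  fix i :: 'b assume i: "i \<in> Basis"
  obtain a d where ad: "integral_vector a" "d \<in> \<int>" "\<And>x. f x \<bullet> i = a \<bullet> x + d"
    using assms(1) i unfolding integer_affine_iff by blast
  obtain a' d' where ad': "integral_vector a'" "d' \<in> \<int>" "\<And>x. g x \<bullet> i = a' \<bullet> x + d'"
    using assms(2) i unfolding integer_affine_iff by blast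
  have "(f x + g x) \<bullet> i = (a + a') \<bullet> x + (d + d')" for x
    using ad ad' by (simp add: inner_add_left)
  then show "\<exists>a d. integral_vector a \<and> d \<in> \<int> \<and> (\<forall>x. (f x + g x) \<bullet> i = a \<bullet> x + d)"
    using ad ad' by (intro exI[of _ "a + a'"] exI[of _ "d + d'"]) (simp add: integral_vector_add)
qed

lemma integer_affine_scaleR:
  assumes "integer_affine f" "integral_vector v"
  shows "integer_affine (\<lambda>x. f x *\<^sub>R v)"
  unfolding integer_affine_iff
proof
  fix i :: 'b assume i: "i \<in> Basis"
  obtain a d where ad: "integral_vector a" "d \<in> \<int>" "\<And>x. f x = a \<bullet> x + d"
    using assms(1) unfolding integer_affine_real_iff by blast
  have vi: "v \<bullet> i \<in> \<int>"
    using assms(2) i by (simp add: integral_vector_def)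
  have "(f x *\<^sub>R v) \<bullet> i = ((v \<bullet> i) *\<^sub>R a) \<bullet> x + (v \<bullet> i) * d" for x
    using ad by (simp add: algebra_simps)
  then show "\<exists>a d. integral_vector a \<and> d \<in> \<int> \<and> (\<forall>x. (f x *\<^sub>R v) \<bullet> i = a \<bullet> x + d)"
    using ad vi by (intro exI[of _ "(v \<bullet> i) *\<^sub>R a"] exI[of _ "(v \<bullet> i) * d"])
      (simp add: integral_vector_scaleR)
qed

lemma continuous_on_integer_affine:
  assumes "integer_affine f"
  shows "continuous_on S f"
  unfolding continuous_on_componentwise[of S f]
proof
  fix i :: 'b assume "i \<in> Basis"
  then obtain a d where "\<And>x. f x \<bullet> i = a \<bullet> x + d"
    using assms unfolding integer_affine_iff by blast
  moreover have "continuous_on S (\<lambda>x. a \<bullet> x + d)"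
    by (intro continuous_intros)
  ultimately show "continuous_on S (\<lambda>x. f x \<bullet> i)"
    by simp
qed

section \<open>Closure properties of integer piecewise affine maps\<close>

lemma Z_map_continuous_on: "Z_map f \<Longrightarrow> continuous_on S f"
  unfolding Z_map_def using continuous_on_subset by blast

lemma Z_mapE:
  assumes "Z_map f"
  obtains F where "finite F" "\<And>u. u \<in> F \<Longrightarrow> integer_affine u" "\<And>x. \<exists>u\<in>F. f x = u x"
  using assms unfolding Z_map_def by blast

lemma Z_map_integer_affine: "integer_affine f \<Longrightarrow> Z_map f"
  unfolding Z_map_def using continuous_on_integer_affine by (auto intro!: exI[of _ "{f}"])

lemma Z_map_inner_add_const:
  "integral_vector a \<Longrightarrow> d \<in> \<int> \<Longrightarrow> Z_map (\<lambda>x. a \<bullet> x + d)"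
  by (intro Z_map_integer_affine) (auto simp: integer_affine_real_iff)

lemma Z_map_const: "d \<in> \<int> \<Longrightarrow> Z_map (\<lambda>x. d :: real)"
  using Z_map_inner_add_const[of 0 d] by (simp add: integral_vector_def)

lemma Z_map_add:
  assumes "Z_map f" "Z_map g"
  shows "Z_map (\<lambda>x. f x + g x)"
proof -
  obtain F where F: "finite F" "\<And>u. u \<in> F \<Longrightarrow> integer_affine u" "\<And>x. \<exists>u\<in>F. f x = u x"
    using Z_mapE[OF assms(1)] by blast
  obtain G where G: "finite G" "\<And>u. u \<in> G \<Longrightarrow> integer_affine u" "\<And>x. \<exists>u\<in>G. g x = u x"
    using Z_mapE[OF assms(2)] by blast
  let ?H = "(\<lambda>(u, w) x. u x + w x) ` (F \<times> G)"
  have "\<exists>h\<in>?H. f x + g x = h x" for x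
  proof -
    obtain u w where "u \<in> F" "f x = u x" "w \<in> G" "g x = w x"
      using F(3) G(3) by blast
    then show ?thesis
      by (intro bexI[of _ "\<lambda>x. u x + w x"]) auto
  qed
  moreover have "\<forall>h\<in>?H. integer_affine h"
    using F(2) G(2) by (auto intro: integer_affine_add)
  moreover have "continuous_on UNIV (\<lambda>x. f x + g x)"
    using assms by (intro continuous_intros Z_map_continuous_on)
  ultimately show ?thesis
    using F(1) G(1) unfolding Z_map_def by (intro conjI exI[of _ ?H]) auto
qed

lemma Z_map_scaleR:
  assumes "Z_map f" "integral_vector v"
  shows "Z_map (\<lambda>x. f x *\<^sub>R v)"
proof -
  obtain F where F: "finite F" "\<And>u. u \<in> F \<Longrightarrow> integer_affine u" "\<And>x. \<exists>u\<in>F. f x = u x"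
    using Z_mapE[OF assms(1)] by blast
  let ?H = "(\<lambda>u x. u x *\<^sub>R v) ` F"
  have "\<exists>h\<in>?H. f x *\<^sub>R v = h x" for x
    using F(3)[of x] by auto
  moreover have "\<forall>h\<in>?H. integer_affine h"
    using F(2) assms(2) by (auto intro: integer_affine_scaleR)
  moreover have "continuous_on UNIV (\<lambda>x. f x *\<^sub>R v)"
    using assms by (intro continuous_intros Z_map_continuous_on)
  ultimately show ?thesis
    using F(1) unfolding Z_map_def by (intro conjI exI[of _ ?H]) auto
qed

lemma Z_map_max:
  fixes f g :: "'a::euclidean_space \<Rightarrow> real"
  assumes "Z_map f" "Z_map g"
  shows "Z_map (\<lambda>x. max (f x) (g x))"
proof -
  obtain F where F: "finite F" "\<And>u. u \<in> F \<Longrightarrow> integer_affine u" "\<And>x. \<exists>u\<in>F. f x = u x"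
    using Z_mapE[OF assms(1)] by blast
  obtain G where G: "finite G" "\<And>u. u \<in> G \<Longrightarrow> integer_affine u" "\<And>x. \<exists>u\<in>G. g x = u x"
    using Z_mapE[OF assms(2)] by blast
  have "\<exists>h\<in>F \<union> G. max (f x) (g x) = h x" for x
    using F(3)[of x] G(3)[of x] unfolding max_def by auto
  moreover have "continuous_on UNIV (\<lambda>x. max (f x) (g x))"
    using assms by (intro continuous_intros Z_map_continuous_on)
  ultimately show ?thesis
    using F G unfolding Z_map_def by (intro conjI exI[of _ "F \<union> G"]) auto
qed

lemma Z_map_cmult:
  fixes f :: "'a::euclidean_space \<Rightarrow> real"
  assumes "Z_map f" "m \<in> \<int>"
  shows "Z_map (\<lambda>x. m * f x)"
  using Z_map_scaleR[of f m] assms by (simp add: mult.commute)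

lemma Z_map_diff:
  fixes f g :: "'a::euclidean_space \<Rightarrow> real"
  assumes "Z_map f" "Z_map g"
  shows "Z_map (\<lambda>x. f x - g x)"
  using Z_map_add[OF assms(1) Z_map_cmult[OF assms(2), of "- 1"]] by simp

lemma Z_map_min:
  fixes f g :: "'a::euclidean_space \<Rightarrow> real"
  assumes "Z_map f" "Z_map g"
  shows "Z_map (\<lambda>x. min (f x) (g x))"
proof -
  have "(\<lambda>x. min (f x) (g x)) = (\<lambda>x. f x + g x - max (f x) (g x))"
    by (auto simp: fun_eq_iff)
  then show ?thesis
    using assms by (simp add: Z_map_add Z_map_diff Z_map_max)
qed

lemma Z_map_abs:
  fixes f :: "'a::euclidean_space \<Rightarrow> real"
  assumes "Z_map f"
  shows "Z_map (\<lambda>x. \<bar>f x\<bar>)"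
proof -
  have "(\<lambda>x. \<bar>f x\<bar>) = (\<lambda>x. max (f x) (- 1 * f x))"
    by auto
  then show ?thesis
    using Z_map_max[OF assms Z_map_cmult[OF assms, of "- 1"]] by simp
qed

lemma Z_map_sum:
  fixes f :: "'k \<Rightarrow> 'a::euclidean_space \<Rightarrow> real"
  assumes "\<And>k. k \<in> I \<Longrightarrow> Z_map (f k)"
  shows "Z_map (\<lambda>x. \<Sum>k\<in>I. f k x)"
  using assms by (induction I rule: infinite_finite_induct) (simp_all add: Z_map_const Z_map_add)

lemma Z_map_shift:
  assumes "Z_map t" "integral_vector v"
  shows "Z_map (\<lambda>x. x + t x *\<^sub>R v)"
  using assms by (simp add: Z_map_add Z_map_scaleR Z_map_integer_affine integer_affine_id)

definition affine_fun :: "'a::real_inner \<times> real \<Rightarrow> 'a \<Rightarrow> real" where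
  "affine_fun h x = fst h \<bullet> x + snd h"

lemma affine_fun_diff: "affine_fun (h - h') x = affine_fun h x - affine_fun h' x"
  by (simp add: affine_fun_def inner_diff_left)

lemma continuous_on_affine_fun [continuous_intros]: "continuous_on S (affine_fun h)"
  unfolding affine_fun_def by (intro continuous_intros)

lemma Z_map_affine_pieces:
  fixes g :: "'a::euclidean_space \<Rightarrow> real"
  assumes "Z_map g"
  obtains P where "finite P" "\<And>h. h \<in> P \<Longrightarrow> integral_vector (fst h)"
    "\<And>x. \<exists>h\<in>P. g x = affine_fun h x"
proof -
  obtain F where F: "finite F" "\<And>u. u \<in> F \<Longrightarrow> integer_affine u" "\<And>x. \<exists>u\<in>F. g x = u x"
    using Z_mapE[OF assms] by blast
  then obtain a d where a: "\<And>u. u \<in> F \<Longrightarrow> integral_vector (a u)"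
      and u: "\<And>u x. u \<in> F \<Longrightarrow> u x = a u \<bullet> x + d u"
    unfolding integer_affine_real_iff by metis
  show ?thesis
  proof
    show "finite ((\<lambda>u. (a u, d u)) ` F)"
      using F(1) by simp
    show "integral_vector (fst h)" if "h \<in> (\<lambda>u. (a u, d u)) ` F" for h
      using that a by auto
    show "\<exists>h\<in>(\<lambda>u. (a u, d u)) ` F. g x = affine_fun h x" for x
      using F(3)[of x] u by (auto simp: affine_fun_def)
  qed
qed

section \<open>Genericity for piecewise affine functions\<close>

lemma closure_diff_hyperplane:
  fixes S :: "'a::euclidean_space set"
  assumes "convex S" "q \<in> S" "a \<bullet> q \<noteq> b"
  shows "closure (S - {x. a \<bullet> x = b}) = closure S"
proof -
  have "affine hull (S \<inter> {x. a \<bullet> x = b}) \<subseteq> {x. a \<bullet> x = b}"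
    by (intro hull_minimal affine_hyperplane) auto
  then have "q \<notin> affine hull (S \<inter> {x. a \<bullet> x = b})"
    using assms(3) by auto
  moreover have "q \<in> affine hull S"
    using assms(2) by (rule hull_inc)
  moreover have "affine hull (S \<inter> {x. a \<bullet> x = b}) \<subseteq> affine hull S"
    by (rule hull_mono) simp
  ultimately have "aff_dim (S \<inter> {x. a \<bullet> x = b}) < aff_dim S"
    by (intro aff_dim_psubset) blast
  then have "closure (S - S \<inter> {x. a \<bullet> x = b}) = closure S"
    using assms(1) by (rule dense_complement_convex)
  then show ?thesis
    by (simp add: Diff_Int_distrib2 Diff_Int)
qed

lemma generic_point_avoiding_zeros:
  fixes S U :: "'a::euclidean_space set" and H :: "('a \<times> real) set"
  assumes S: "closed S" "convex S" and U: "open U" "S \<inter> U \<noteq> {}"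
    and H: "countable H" "\<And>h. h \<in> H \<Longrightarrow> \<exists>q\<in>S. affine_fun h q \<noteq> 0"
  obtains p where "p \<in> S" "p \<in> U" "\<And>h. h \<in> H \<Longrightarrow> affine_fun h p \<noteq> 0"
proof -
  define Z where "Z = (\<lambda>h :: 'a \<times> real. {x. fst h \<bullet> x = - snd h})"
  have Z: "x \<in> Z h \<longleftrightarrow> affine_fun h x = 0" for x h
    by (auto simp: Z_def affine_fun_def)
  define \<G> where "\<G> = insert S ((\<lambda>h. S - Z h) ` H)"
  have "openin (top_of_set S) (S - Z h) \<and> S \<subseteq> closure (S - Z h)" if h: "h \<in> H" for h
  proof
    obtain q where "q \<in> S" "fst h \<bullet> q \<noteq> - snd h"
      using H(2)[OF h] by (auto simp: affine_fun_def)
    then have "closure (S - Z h) = closure S"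
      unfolding Z_def using S(2) by (intro closure_diff_hyperplane)
    then show "S \<subseteq> closure (S - Z h)"
      using closure_subset by blast
    show "openin (top_of_set S) (S - Z h)"
      unfolding Z_def Diff_eq by (intro openin_open_Int open_Compl closed_hyperplane)
  qed
  then have "S \<subseteq> closure (\<Inter>\<G>)"
    using S(1) H(1) closure_subset by (intro Baire) (auto simp: \<G>_def)
  then have "U \<inter> \<Inter>\<G> \<noteq> {}"
    using U open_Int_closure_eq_empty[OF U(1), of "\<Inter>\<G>"] by blast
  then obtain p where p: "p \<in> U" "\<And>T. T \<in> \<G> \<Longrightarrow> p \<in> T"
    by blast
  show ?thesis
  proof (rule that[OF _ \<open>p \<in> U\<close>])
    show "p \<in> S"
      by (rule p) (simp add: \<G>_def)
    show "affine_fun h p \<noteq> 0" if "h \<in> H" for h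
      using p(2)[of "S - Z h"] that by (simp add: \<G>_def Z)
  qed
qed

lemma connected_selects_one_piece:
  fixes g :: "'a::topological_space \<Rightarrow> 'b::real_normed_vector" and u :: "'i \<Rightarrow> 'a \<Rightarrow> 'b"
  assumes B: "connected B" "B \<noteq> {}" and g: "continuous_on B g"
    and u: "finite I" "\<And>i. i \<in> I \<Longrightarrow> continuous_on B (u i)" "\<And>x. x \<in> B \<Longrightarrow> \<exists>i\<in>I. g x = u i x"
    and disjoint: "\<And>i j x. i \<in> I \<Longrightarrow> j \<in> I \<Longrightarrow> x \<in> B \<Longrightarrow> u i x = u j x \<Longrightarrow> i = j"
  obtains i where "i \<in> I" "\<And>x. x \<in> B \<Longrightarrow> g x = u i x"
proof -
  define E where "E = (\<lambda>i. {x \<in> B. g x = u i x})"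
  have closed: "closedin (top_of_set B) (E i)" if "i \<in> I" for i
  proof -
    have "E i = B \<inter> (\<lambda>x. g x - u i x) -` {0}"
      by (auto simp: E_def)
    then show ?thesis
      using g u(2)[OF that] by (auto intro!: continuous_closedin_preimage continuous_on_diff)
  qed
  obtain b i where b: "b \<in> B" and i: "i \<in> I" "g b = u i b"
    using B(2) u(3) by blast
  have "E i = B - (\<Union>j\<in>I - {i}. E j)"
  proof
    show "E i \<subseteq> B - (\<Union>j\<in>I - {i}. E j)"
      using disjoint i(1) by (force simp: E_def)
    show "B - (\<Union>j\<in>I - {i}. E j) \<subseteq> E i"
      using u(3) by (force simp: E_def)
  qed
  moreover have "closedin (top_of_set B) (\<Union>j\<in>I - {i}. E j)"
    using u(1) closed by (intro closedin_Union) auto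
  ultimately have "openin (top_of_set B) (E i)"
    by (metis openin_diff openin_subtopology_self)
  then have "E i = B"
    using B(1) closed[OF i(1)] b i(2) unfolding connected_clopen by (auto simp: E_def)
  then show ?thesis
    using that i(1) by (auto simp: E_def)
qed

lemma affine_fun_eq_zero_if_vanishes_on_hyperplane:
  assumes vanish: "\<And>x. n \<bullet> x = n \<bullet> p \<Longrightarrow> affine_fun h x = 0"
    and y: "n \<bullet> y \<noteq> n \<bullet> p" "affine_fun h y = 0"
  shows "h = 0"
proof -
  define a where "a = fst h"
  have along: "a \<bullet> w = 0" if "n \<bullet> w = 0" for w
    using vanish[of p] vanish[of "p + w"] that by (simp add: a_def affine_fun_def inner_add_right)
  have across: "a \<bullet> (y - p) = 0"
    using vanish[of p] y(2) by (simp add: a_def affine_fun_def inner_diff_right)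
  define c where "c = (n \<bullet> a) / (n \<bullet> (y - p))"
  have "n \<bullet> (a - c *\<^sub>R (y - p)) = 0"
    using y(1) by (simp add: c_def inner_diff_right)
  then have "a \<bullet> (a - c *\<^sub>R (y - p)) = 0"
    by (rule along)
  then have "a \<bullet> a = 0"
    using across by (simp only: inner_diff_right inner_scaleR_right)
  then show ?thesis
    using y(2) by (simp add: a_def affine_fun_def prod_eq_iff)
qed

lemma affine_funs_distinct_near:
  fixes P :: "('a::real_inner \<times> real) set"
  assumes "finite P"
  obtains e where "e > 0" "\<And>x h h'. x \<in> ball p e \<Longrightarrow> h \<in> P \<Longrightarrow> h' \<in> P \<Longrightarrow>
    affine_fun h x = affine_fun h' x \<Longrightarrow> affine_fun h p = affine_fun h' p"
proof -
  have "\<forall>\<^sub>F x in nhds p. affine_fun h x = affine_fun h' x \<longrightarrow> affine_fun h p = affine_fun h' p" for h h'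
  proof (cases "affine_fun h p = affine_fun h' p")
    case False
    have "open {x. affine_fun h x \<noteq> affine_fun h' x}"
      by (intro open_Collect_neq continuous_intros)
    then show ?thesis
      using False by (auto simp: eventually_nhds)
  qed simp
  then have "\<forall>\<^sub>F x in nhds p. \<forall>h\<in>P. \<forall>h'\<in>P. affine_fun h x = affine_fun h' x \<longrightarrow>
      affine_fun h p = affine_fun h' p"
    using assms by (intro eventually_ball_finite ballI)
  then obtain e where "e > 0" "\<And>x. dist x p < e \<Longrightarrow> \<forall>h\<in>P. \<forall>h'\<in>P.
      affine_fun h x = affine_fun h' x \<longrightarrow> affine_fun h p = affine_fun h' p"
    unfolding eventually_nhds_metric by blast
  then show ?thesis
    by (intro that[of e]) (auto simp: dist_commute)
qed

lemma affine_funs_distinct_beside_hyperplane: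
  fixes P :: "('a::euclidean_space \<times> real) set"
  assumes P: "finite P" and U: "open U" "{x. n \<bullet> x = k} \<inter> U \<noteq> {}"
  obtains p e where "p \<in> U" "n \<bullet> p = k" "e > 0"
    "\<And>h h' x. h \<in> P \<Longrightarrow> h' \<in> P \<Longrightarrow> x \<in> ball p e \<Longrightarrow> n \<bullet> x \<noteq> k \<Longrightarrow>
       affine_fun h x = affine_fun h' x \<Longrightarrow> h = h'"
proof -
  define H where
    "H = {f \<in> (\<lambda>(h, h'). h - h') ` (P \<times> P). \<exists>q\<in>{x. n \<bullet> x = k}. affine_fun f q \<noteq> 0}"
  have "countable H"
    using P by (simp add: H_def countable_finite)
  moreover have "\<exists>q\<in>{x. n \<bullet> x = k}. affine_fun f q \<noteq> 0" if "f \<in> H" for f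
    using that by (simp add: H_def)
  ultimately obtain p where p: "p \<in> {x. n \<bullet> x = k}" "p \<in> U"
      and avoid: "\<And>f. f \<in> H \<Longrightarrow> affine_fun f p \<noteq> 0"
    using generic_point_avoiding_zeros[OF closed_hyperplane convex_hyperplane U] by blast
  obtain e where e: "e > 0" and near: "\<And>x h h'. x \<in> ball p e \<Longrightarrow> h \<in> P \<Longrightarrow> h' \<in> P \<Longrightarrow>
      affine_fun h x = affine_fun h' x \<Longrightarrow> affine_fun h p = affine_fun h' p"
    using affine_funs_distinct_near[OF P] by blast
  show ?thesis
  proof (rule that[OF \<open>p \<in> U\<close> _ e])
    fix h h' x
    assume h: "h \<in> P" "h' \<in> P" and x: "x \<in> ball p e" "n \<bullet> x \<noteq> k" "affine_fun h x = affine_fun h' x"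
    have "affine_fun (h - h') p = 0"
      using near[OF x(1) h x(3)] by (simp add: affine_fun_diff)
    then have "h - h' \<notin> H"
      using avoid by blast
    moreover have "h - h' \<in> (\<lambda>(h, h'). h - h') ` (P \<times> P)"
      using h by (intro image_eqI[of _ _ "(h, h')"]) simp_all
    ultimately have "affine_fun (h - h') y = 0" if "n \<bullet> y = n \<bullet> p" for y
      using that p(1) by (simp add: H_def)
    then have "h - h' = 0"
      using x p(1)
      by (intro affine_fun_eq_zero_if_vanishes_on_hyperplane[of n p _ x]) (simp_all add: affine_fun_diff)
    then show "h = h'"
      by simp
  qed (use p in simp)
qed

lemma affine_piece_beside_hyperplane:
  fixes g :: "'a::euclidean_space \<Rightarrow> real"
  assumes g: "continuous_on UNIV g" and P: "finite P" "\<And>x. \<exists>h\<in>P. g x = affine_fun h x"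
    and n: "n \<noteq> 0" and U: "open U" "{x. n \<bullet> x = k} \<inter> U \<noteq> {}"
  obtains p e h where "p \<in> U" "n \<bullet> p = k" "e > 0" "h \<in> P"
    "\<And>x. x \<in> ball p e \<Longrightarrow> k \<le> n \<bullet> x \<Longrightarrow> g x = affine_fun h x"
proof -
  obtain p e where p: "p \<in> U" "n \<bullet> p = k" and e: "e > 0"
      and distinct: "\<And>h h' x. h \<in> P \<Longrightarrow> h' \<in> P \<Longrightarrow> x \<in> ball p e \<Longrightarrow> n \<bullet> x \<noteq> k \<Longrightarrow>
        affine_fun h x = affine_fun h' x \<Longrightarrow> h = h'"
    using affine_funs_distinct_beside_hyperplane[OF P(1) U] by blast
  define B where "B = ball p e \<inter> {x. n \<bullet> x > k}"
  have "p \<in> ball p e \<inter> closure {x. n \<bullet> x > k}"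
    using n e p(2) by simp
  then have "B \<noteq> {}"
    unfolding B_def by (metis open_ball open_Int_closure_eq_empty empty_iff)
  moreover have "connected B"
    unfolding B_def by (intro convex_connected convex_Int convex_ball convex_halfspace_gt)
  moreover have "h = h'" if "h \<in> P" "h' \<in> P" "x \<in> B" "affine_fun h x = affine_fun h' x" for h h' x
    using that by (intro distinct[of h h' x]) (simp_all add: B_def)
  ultimately obtain h where h: "h \<in> P" "\<And>x. x \<in> B \<Longrightarrow> g x = affine_fun h x"
    using connected_selects_one_piece[of B g P affine_fun] continuous_on_subset[OF g] P
      continuous_on_affine_fun by blast
  have "closed {x. g x = affine_fun h x}"
    using g by (intro closed_Collect_eq continuous_intros)
  then have "closure B \<subseteq> {x. g x = affine_fun h x}"
    using h(2) by (intro closure_minimal) auto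
  moreover have "ball p e \<inter> {x. n \<bullet> x \<ge> k} \<subseteq> closure B"
    unfolding B_def using open_Int_closure_subset[of "ball p e" "{x. n \<bullet> x > k}"] n by simp
  ultimately have "g x = affine_fun h x" if "x \<in> ball p e" "k \<le> n \<bullet> x" for x
    using that by blast
  then show ?thesis
    by (rule that[OF p e h(1)])
qed

lemma nonconstant_affine_piece_beside_hyperplane:
  fixes g :: "'a::euclidean_space \<Rightarrow> real"
  assumes g: "continuous_on UNIV g" and P: "finite P" "\<And>x. \<exists>h\<in>P. g x = affine_fun h x"
    and n: "n \<noteq> 0" and U: "open U" "connected ({x. n \<bullet> x = k} \<inter> U)"
    and nonconst: "\<not> g constant_on {x. n \<bullet> x = k} \<inter> U"
  obtains p e h w where "p \<in> U" "n \<bullet> p = k" "e > 0" "h \<in> P"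
    "\<And>x. x \<in> ball p e \<Longrightarrow> k \<le> n \<bullet> x \<Longrightarrow> g x = affine_fun h x" "n \<bullet> w = 0" "fst h \<bullet> w \<noteq> 0"
proof -
  let ?S = "{x. n \<bullet> x = k}"
  define V where "V = {y. \<exists>h\<in>P. \<forall>x\<in>?S \<inter> U. affine_fun h x = y}"
  obtain s where s: "s \<in> ?S \<inter> U"
    using nonconst unfolding constant_on_def by blast
  then have "V \<subseteq> (\<lambda>h. affine_fun h s) ` P"
    by (force simp: V_def)
  then have "finite V"
    using P(1) finite_surj by blast
  have "\<not> g ` (?S \<inter> U) \<subseteq> V"
    using continuous_finite_range_constant[OF U(2)] continuous_on_subset[OF g] nonconst
      finite_subset[OF _ \<open>finite V\<close>] by blast
  then have "?S \<inter> (U \<inter> g -` (- V)) \<noteq> {}"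
    by blast
  moreover have "open (U \<inter> g -` (- V))"
    using U(1) g \<open>finite V\<close> by (intro open_Int open_vimage) (auto intro: finite_imp_closed)
  ultimately obtain p e h where "p \<in> U \<inter> g -` (- V)" and p: "n \<bullet> p = k" and e: "e > 0"
      and h: "h \<in> P" and aff: "\<And>x. x \<in> ball p e \<Longrightarrow> k \<le> n \<bullet> x \<Longrightarrow> g x = affine_fun h x"
    using affine_piece_beside_hyperplane[OF g P n, of "U \<inter> g -` (- V)" k] by metis
  then have "p \<in> U" "g p \<notin> V"
    by auto
  obtain x where x: "n \<bullet> x = k" "affine_fun h x \<noteq> g p"
    using \<open>g p \<notin> V\<close> h unfolding V_def by blast
  show ?thesis
  proof (rule that[OF \<open>p \<in> U\<close> p e h aff])
    show "n \<bullet> (x - p) = 0" "fst h \<bullet> (x - p) \<noteq> 0"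
      using x p aff[of p] e by (auto simp: inner_diff_right affine_fun_def)
  qed
qed

section \<open>Absorbing shifts\<close>

lemma grid_point_near:
  fixes p :: "'a::euclidean_space" and N :: nat
  assumes N: "N > 0"
  obtains r where "integral_vector (real N *\<^sub>R r)" "norm (p - r) \<le> real DIM('a) / real N"
    "\<And>b. b \<in> Basis \<Longrightarrow> p \<bullet> b \<in> \<int> \<Longrightarrow> r \<bullet> b = p \<bullet> b"
proof -
  define r where "r = (\<Sum>b\<in>Basis. (of_int \<lfloor>N * (p \<bullet> b)\<rfloor> / N) *\<^sub>R b)"
  have r: "N * (r \<bullet> b) = of_int \<lfloor>N * (p \<bullet> b)\<rfloor>" if "b \<in> Basis" for b
    using that N by (simp add: r_def)
  have "\<bar>(p - r) \<bullet> b\<bar> \<le> 1 / N" if "b \<in> Basis" for b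
  proof -
    have "N * ((p - r) \<bullet> b) = N * (p \<bullet> b) - of_int \<lfloor>N * (p \<bullet> b)\<rfloor>"
      using r[OF that] by (simp add: inner_diff_left right_diff_distrib)
    also have "\<bar>\<dots>\<bar> \<le> 1"
      by linarith
    finally show ?thesis
      using N by (simp add: abs_mult field_simps)
  qed
  then have "(\<Sum>b\<in>Basis. \<bar>(p - r) \<bullet> b\<bar>) \<le> real DIM('a) * (1 / N)"
    by (intro sum_bounded_above)
  then have "norm (p - r) \<le> real DIM('a) / N"
    using norm_le_l1[of "p - r"] by simp
  moreover have "integral_vector (real N *\<^sub>R r)"
    using r by (simp add: integral_vector_def)
  moreover have "r \<bullet> b = p \<bullet> b" if "b \<in> Basis" "p \<bullet> b \<in> \<int>" for b
  proof -
    have "N * (r \<bullet> b) = N * (p \<bullet> b)"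
      unfolding r[OF that(1)] using that(2) by (simp add: of_int_floor_cancel)
    then show ?thesis
      using N by simp
  qed
  ultimately show ?thesis
    using that by blast
qed

lemma rational_point_near:
  fixes p :: "'a::euclidean_space"
  assumes U: "open U" "p \<in> U"
  obtains r and m :: int where "r \<in> U" "m > 0" "integral_vector (of_int m *\<^sub>R r)"
    "\<And>b. b \<in> Basis \<Longrightarrow> p \<bullet> b \<in> \<int> \<Longrightarrow> r \<bullet> b = p \<bullet> b"
proof -
  obtain e where e: "e > 0" "ball p e \<subseteq> U"
    using U open_contains_ball by metis
  obtain k where k: "1 / real (Suc k) < e / real DIM('a)"
    using e(1) by (meson DIM_positive divide_pos_pos nat_approx_posE of_nat_0_less_iff)
  obtain r where r: "integral_vector (real (Suc k) *\<^sub>R r)" "norm (p - r) \<le> real DIM('a) / real (Suc k)"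
    and r_eq: "\<And>b. b \<in> Basis \<Longrightarrow> p \<bullet> b \<in> \<int> \<Longrightarrow> r \<bullet> b = p \<bullet> b"
    using grid_point_near[of "Suc k" p] by blast
  note r(2)
  also have "real DIM('a) / real (Suc k) < e"
    using k by (simp add: field_simps)
  finally have "r \<in> U"
    using e(2) by (auto simp: dist_norm)
  then show ?thesis
    using r(1) r_eq by (intro that[of r "int (Suc k)"]) simp_all
qed

lemma inner_integral_vectors_ge_1:
  assumes "integral_vector u" "integral_vector v" "u \<bullet> v > 0"
  shows "u \<bullet> v \<ge> 1"
  using integral_vector_inner[OF assms(1,2)] assms(3) by (auto elim!: Ints_cases)

text \<open>\<open>n \<bullet> v\<close> times the projection along \<open>v\<close> onto the orthogonal complement of \<open>n\<close>; without
  the division it preserves integrality.\<close>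

definition oblique_projection :: "'a::real_inner \<Rightarrow> 'a \<Rightarrow> 'a \<Rightarrow> 'a" where
  "oblique_projection n v x = (n \<bullet> v) *\<^sub>R x - (n \<bullet> x) *\<^sub>R v"

lemma oblique_projection_add:
  "oblique_projection n v (x + y) = oblique_projection n v x + oblique_projection n v y"
  by (simp add: oblique_projection_def algebra_simps)

lemma oblique_projection_scaleR:
  "oblique_projection n v (c *\<^sub>R x) = c *\<^sub>R oblique_projection n v x"
  by (simp add: oblique_projection_def algebra_simps)

lemma oblique_projection_diff:
  "oblique_projection n v (x - y) = oblique_projection n v x - oblique_projection n v y"
  by (simp add: oblique_projection_def algebra_simps)

lemma oblique_projection_self: "oblique_projection n v v = 0"
  by (simp add: oblique_projection_def)

lemma norm_le_oblique_projection:
  assumes "n \<bullet> v \<ge> 1"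
  shows "norm x \<le> norm (oblique_projection n v x) + \<bar>n \<bullet> x\<bar> * norm v"
proof -
  have "norm x \<le> norm ((n \<bullet> v) *\<^sub>R x)"
    using assms mult_right_mono[of 1 "n \<bullet> v" "norm x"] by simp
  also have "\<dots> = norm (oblique_projection n v x + (n \<bullet> x) *\<^sub>R v)"
    by (simp add: oblique_projection_def)
  also have "\<dots> \<le> norm (oblique_projection n v x) + \<bar>n \<bullet> x\<bar> * norm v"
    using norm_triangle_ineq by (metis norm_scaleR)
  finally show ?thesis .
qed

lemma integral_vector_oblique_projection:
  "integral_vector n \<Longrightarrow> integral_vector v \<Longrightarrow> integral_vector x \<Longrightarrow>
    integral_vector (oblique_projection n v x)"
  unfolding oblique_projection_def
  by (intro integral_vector_diff integral_vector_scaleR integral_vector_inner)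

lemma Z_map_oblique_projection_inner:
  assumes "integral_vector n" "integral_vector v" "integral_vector b"
  shows "Z_map (\<lambda>x. oblique_projection n v x \<bullet> b)"
proof -
  have "oblique_projection n v x \<bullet> b = ((n \<bullet> v) *\<^sub>R b - (v \<bullet> b) *\<^sub>R n) \<bullet> x + 0" for x
    by (simp add: oblique_projection_def inner_commute algebra_simps)
  moreover have "integral_vector ((n \<bullet> v) *\<^sub>R b - (v \<bullet> b) *\<^sub>R n)"
    using assms by (intro integral_vector_diff integral_vector_scaleR integral_vector_inner)
  ultimately show ?thesis
    by (simp only: Z_map_inner_add_const Ints_0)
qed

lemma Z_map_distance_to_line:
  fixes n v r :: "'a::euclidean_space" and m :: int
  assumes n: "integral_vector n" and v: "integral_vector v" "n \<bullet> v > 0"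
    and r: "m > 0" "integral_vector (of_int m *\<^sub>R r)"
  obtains D where "Z_map D" "\<And>x c. D (x + c *\<^sub>R v) = D x" "\<And>c e. D (r + c *\<^sub>R e) = \<bar>c\<bar> * D (r + e)"
    "\<And>x. norm (x - r) \<le> D x + \<bar>n \<bullet> (x - r)\<bar> * norm v"
proof -
  let ?\<pi> = "oblique_projection n v"
  define D where "D x = (\<Sum>b\<in>Basis. \<bar>of_int m * (?\<pi> x \<bullet> b) - ?\<pi> (of_int m *\<^sub>R r) \<bullet> b\<bar>)" for x
  have m: "real_of_int m \<ge> 1"
    using r(1) by simp
  have "of_int m * (?\<pi> x \<bullet> b) - ?\<pi> (of_int m *\<^sub>R r) \<bullet> b = of_int m * (?\<pi> (x - r) \<bullet> b)" for x b
    by (simp add: oblique_projection_scaleR oblique_projection_diff inner_diff_left right_diff_distrib)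
  then have D: "D x = of_int m * (\<Sum>b\<in>Basis. \<bar>?\<pi> (x - r) \<bullet> b\<bar>)" for x
    using m by (simp add: D_def abs_mult sum_distrib_left)
  show ?thesis
  proof
    have "?\<pi> (of_int m *\<^sub>R r) \<bullet> b \<in> \<int>" if "b \<in> Basis" for b
      using integral_vector_oblique_projection[OF n v(1) r(2)] that by (simp add: integral_vector_def)
    then show "Z_map D"
      unfolding D_def using n v(1)
      by (intro Z_map_sum Z_map_abs Z_map_diff Z_map_cmult Z_map_const
          Z_map_oblique_projection_inner) (simp_all add: integral_vector_Basis)
    show "D (x + c *\<^sub>R v) = D x" for x c
      by (simp add: D oblique_projection_diff oblique_projection_add oblique_projection_scaleR
          oblique_projection_self)
    show "D (r + c *\<^sub>R e) = \<bar>c\<bar> * D (r + e)" for c e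
      by (simp add: D oblique_projection_scaleR abs_mult sum_distrib_left[symmetric])
    show "norm (x - r) \<le> D x + \<bar>n \<bullet> (x - r)\<bar> * norm v" for x
    proof -
      have "norm (?\<pi> (x - r)) \<le> 1 * (\<Sum>b\<in>Basis. \<bar>?\<pi> (x - r) \<bullet> b\<bar>)"
        using norm_le_l1 by simp
      also have "\<dots> \<le> D x"
        unfolding D using m by (intro mult_right_mono sum_nonneg) simp_all
      finally show ?thesis
        using norm_le_oblique_projection[OF inner_integral_vectors_ge_1[OF n v], of "x - r"] by linarith
    qed
  qed
qed

text \<open>The tent \<open>max 0 (1 - N * y)\<close> has height \<open>1\<close>; taking the minimum with \<open>y\<close> keeps it low
  without leaving the integer coefficients, at the price of vanishing at \<open>y = 0\<close>.\<close>

definition low_tent :: "real \<Rightarrow> real \<Rightarrow> real" where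
  "low_tent N y = max 0 (min y (1 - N * y))"

lemma low_tent_pos_iff: "N > 0 \<Longrightarrow> 0 < low_tent N y \<longleftrightarrow> 0 < y \<and> y < 1 / N"
  by (auto simp: low_tent_def field_simps)

lemma low_tent_le:
  assumes "N > 0"
  shows "low_tent N y \<le> 1 / N"
proof (cases "y \<le> 1 / N")
  case True
  then show ?thesis
    using assms by (simp add: low_tent_def min.coboundedI1)
next
  case False
  then have "1 - N * y \<le> 0"
    using assms by (simp add: field_simps)
  then show ?thesis
    using assms by (simp add: low_tent_def min.coboundedI2 order.trans[of _ 0])
qed

lemma Z_map_low_tent: "Z_map f \<Longrightarrow> N \<in> \<int> \<Longrightarrow> Z_map (\<lambda>x. low_tent N (f x))"
  unfolding low_tent_def by (intro Z_map_max Z_map_min Z_map_diff Z_map_cmult Z_map_const) simp_all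

lemma Z_map_thin_bump_along_line:
  fixes n v r :: "'a::euclidean_space" and m :: int
  assumes "integral_vector n" "integral_vector v" "n \<bullet> v > 0"
    and "m > 0" "integral_vector (of_int m *\<^sub>R r)" and \<epsilon>: "\<epsilon> > 0"
  obtains h where "Z_map h" "\<And>x. h x \<le> \<epsilon>" "\<And>x c. h (x + c *\<^sub>R v) = h x"
    "\<And>x. h x > 0 \<Longrightarrow> norm (x - r) \<le> \<epsilon> + \<bar>n \<bullet> (x - r)\<bar> * norm v"
    "\<And>e. e \<noteq> 0 \<Longrightarrow> n \<bullet> e = 0 \<Longrightarrow> \<exists>c. h (r + c *\<^sub>R e) > 0"
proof -
  obtain D where D: "Z_map D" and D_shift: "\<And>x c. D (x + c *\<^sub>R v) = D x"
    and D_scale: "\<And>c e. D (r + c *\<^sub>R e) = \<bar>c\<bar> * D (r + e)"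
    and D_norm: "\<And>x. norm (x - r) \<le> D x + \<bar>n \<bullet> (x - r)\<bar> * norm v"
    using Z_map_distance_to_line[OF assms(1-5)] by blast
  obtain k where k: "1 / real (Suc k) < \<epsilon>"
    using \<epsilon> by (rule nat_approx_posE)
  define N where "N = real (Suc k)"
  have N: "N > 0" "1 / N < \<epsilon>" "N \<in> \<int>"
    using k by (simp_all add: N_def)
  show ?thesis
  proof
    show "Z_map (\<lambda>x. low_tent N (D x))"
      using D N(3) by (rule Z_map_low_tent)
    show "low_tent N (D x) \<le> \<epsilon>" for x
      using low_tent_le[of N "D x"] N by linarith
    show "low_tent N (D (x + c *\<^sub>R v)) = low_tent N (D x)" for x c
      by (simp add: D_shift)
    show "norm (x - r) \<le> \<epsilon> + \<bar>n \<bullet> (x - r)\<bar> * norm v" if "low_tent N (D x) > 0" for x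
      using that N D_norm[of x] by (simp add: low_tent_pos_iff)
    show "\<exists>c. low_tent N (D (r + c *\<^sub>R e)) > 0" if "e \<noteq> 0" "n \<bullet> e = 0" for e
    proof
      have "D (r + e) > 0"
        using D_norm[of "r + e"] that by (simp add: order.strict_trans2[of 0 "norm e"])
      then have "D (r + (1 / (2 * N * D (r + e))) *\<^sub>R e) = 1 / (2 * N)"
        using N(1) by (simp add: D_scale)
      moreover have "low_tent N (1 / (2 * N)) > 0"
        using N(1) by (simp add: low_tent_pos_iff field_simps)
      ultimately show "low_tent N (D (r + (1 / (2 * N * D (r + e))) *\<^sub>R e)) > 0"
        by (simp only:)
    qed
  qed
qed

lemma truncated_difference_absorbed:
  fixes h t :: "'a::real_inner \<Rightarrow> real"
  assumes t: "\<And>x. t x = max 0 (h x - (n \<bullet> x + k))"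
    and h: "\<And>x c. h (x + c *\<^sub>R v) = h x" and v: "n \<bullet> v \<ge> 1"
  shows "t (x + t x *\<^sub>R v) = 0"
proof -
  have "t x * 1 \<le> t x * (n \<bullet> v)"
    using v by (intro mult_left_mono) (simp_all add: t)
  moreover have "h x - (n \<bullet> x + k) \<le> t x"
    by (simp add: t)
  ultimately show ?thesis
    unfolding t[of "x + t x *\<^sub>R v"] by (simp add: h inner_add_right)
qed

lemma bounded_shift_in_ball:
  fixes x r v :: "'a::real_normed_vector"
  assumes x: "norm (x - r) \<le> \<epsilon> + \<epsilon> * norm v" and c: "0 \<le> c" "c \<le> \<epsilon>"
    and \<delta>: "\<epsilon> * (1 + 2 * norm v) < \<delta>"
  shows "x \<in> ball r \<delta> \<and> x + c *\<^sub>R v \<in> ball r \<delta>"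
proof -
  have "norm (c *\<^sub>R v) \<le> \<epsilon> * norm v"
    using c by (simp add: mult_right_mono)
  moreover have "norm (x + c *\<^sub>R v - r) \<le> norm (x - r) + norm (c *\<^sub>R v)"
    by (metis add_diff_eq add.commute norm_triangle_ineq)
  moreover have "\<epsilon> + \<epsilon> * norm v + \<epsilon> * norm v < \<delta>"
    using \<delta> by (simp add: algebra_simps)
  ultimately have "norm (x - r) < \<delta>" "norm (x + c *\<^sub>R v - r) < \<delta>"
    using x norm_ge_zero[of "c *\<^sub>R v"] by linarith+
  then show ?thesis
    by (simp add: dist_norm norm_minus_commute)
qed

lemma Z_map_absorbing_shift:
  fixes n v r e :: "'a::euclidean_space" and m :: int
  assumes n: "integral_vector n" "n \<bullet> r \<in> \<int>" and v: "integral_vector v" "n \<bullet> v > 0"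
    and r: "m > 0" "integral_vector (of_int m *\<^sub>R r)"
    and e: "e \<noteq> 0" "n \<bullet> e = 0" and \<delta>: "\<delta> > 0"
  obtains t where "Z_map t" "\<And>x. t x \<ge> 0" "\<And>x. t (x + t x *\<^sub>R v) = 0"
    "\<And>x. n \<bullet> r \<le> n \<bullet> x \<Longrightarrow> t x > 0 \<Longrightarrow> x \<in> ball r \<delta> \<and> x + t x *\<^sub>R v \<in> ball r \<delta>"
    "\<exists>y. n \<bullet> y = n \<bullet> r \<and> t y > 0"
proof -
  have pos: "1 + 2 * norm v > 0"
    using norm_ge_zero[of v] by linarith
  then obtain \<epsilon> where \<epsilon>: "0 < \<epsilon>" "\<epsilon> < \<delta> / (1 + 2 * norm v)"
    using \<delta> dense by (metis divide_pos_pos)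
  then have \<epsilon>_sum: "\<epsilon> * (1 + 2 * norm v) < \<delta>"
    using pos by (simp add: pos_less_divide_eq)
  obtain h where h: "Z_map h" "\<And>x. h x \<le> \<epsilon>" "\<And>x c. h (x + c *\<^sub>R v) = h x"
    and h_near: "\<And>x. h x > 0 \<Longrightarrow> norm (x - r) \<le> \<epsilon> + \<bar>n \<bullet> (x - r)\<bar> * norm v"
    and h_pos: "\<And>e. e \<noteq> 0 \<Longrightarrow> n \<bullet> e = 0 \<Longrightarrow> \<exists>c. h (r + c *\<^sub>R e) > 0"
    using Z_map_thin_bump_along_line[OF n(1) v r \<epsilon>(1)] by blast
  define t where "t x = max 0 (h x - (n \<bullet> x + - (n \<bullet> r)))" for x
  show ?thesis
  proof
    show "Z_map t"
      unfolding t_def using n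
      by (intro Z_map_max Z_map_diff Z_map_const Z_map_inner_add_const h) simp_all
    show "t x \<ge> 0" for x
      by (simp add: t_def)
    show "t (x + t x *\<^sub>R v) = 0" for x
      using t_def h(3) inner_integral_vectors_ge_1[OF n(1) v] by (rule truncated_difference_absorbed)
    show "x \<in> ball r \<delta> \<and> x + t x *\<^sub>R v \<in> ball r \<delta>" if x: "n \<bullet> r \<le> n \<bullet> x" "t x > 0" for x
    proof (rule bounded_shift_in_ball[OF _ _ _ \<epsilon>_sum])
      have near: "0 < h x" "\<bar>n \<bullet> (x - r)\<bar> \<le> \<epsilon>"
        using x h(2)[of x] by (auto simp: t_def inner_diff_right)
      then have "\<bar>n \<bullet> (x - r)\<bar> * norm v \<le> \<epsilon> * norm v"
        by (simp add: mult_right_mono)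
      then show "norm (x - r) \<le> \<epsilon> + \<epsilon> * norm v"
        using h_near[OF near(1)] by linarith
      show "0 \<le> t x" "t x \<le> \<epsilon>"
        using x h(2)[of x] by (auto simp: t_def)
    qed
    obtain c where "h (r + c *\<^sub>R e) > 0"
      using h_pos e by blast
    then show "\<exists>y. n \<bullet> y = n \<bullet> r \<and> t y > 0"
      using e(2) by (intro exI[of _ "r + c *\<^sub>R e"]) (simp add: t_def inner_add_right)
  qed
qed

lemma integral_vector_orthogonal_inward:
  fixes a n w :: "'a::euclidean_space"
  assumes "integral_vector a" "integral_vector n" "n \<noteq> 0" "n \<bullet> w = 0" "a \<bullet> w \<noteq> 0"
  obtains v where "integral_vector v" "a \<bullet> v = 0" "n \<bullet> v > 0"
proof
  define v where "v = (a \<bullet> a) *\<^sub>R n - (a \<bullet> n) *\<^sub>R a"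
  show "integral_vector v"
    unfolding v_def using assms by (intro integral_vector_diff integral_vector_scaleR integral_vector_inner)
  show av: "a \<bullet> v = 0"
    by (simp add: v_def inner_diff_right)
  have "a \<bullet> a > 0"
    using assms(5) by auto
  have "v \<noteq> 0"
  proof
    assume "v = 0"
    then have "v \<bullet> w = 0" "v \<bullet> n = 0"
      by simp_all
    then have "a \<bullet> n = 0" "(a \<bullet> a) * (n \<bullet> n) = (a \<bullet> n) * (a \<bullet> n)"
      using assms(4,5) by (simp_all add: v_def inner_diff_left)
    then show False
      using \<open>a \<bullet> a > 0\<close> assms(3) by simp
  qed
  moreover have "v \<bullet> v = (a \<bullet> a) * (n \<bullet> v)"
    using av by (simp add: v_def inner_diff_left)
  ultimately show "n \<bullet> v > 0"
    using \<open>a \<bullet> a > 0\<close> by (metis inner_gt_zero_iff zero_less_mult_pos)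
qed

section \<open>The unit cube near a facet\<close>

definition cube_facet :: "'a::euclidean_space \<Rightarrow> real \<Rightarrow> 'a set" where
  "cube_facet i c = {x \<in> cbox 0 One. x \<bullet> i = c}"

definition cube_facet_interior :: "'a::euclidean_space \<Rightarrow> real \<Rightarrow> 'a set" where
  "cube_facet_interior i c = {x. x \<bullet> i = c \<and> (\<forall>b\<in>Basis - {i}. 0 < x \<bullet> b \<and> x \<bullet> b < 1)}"

definition facet_collar :: "'a::euclidean_space \<Rightarrow> real \<Rightarrow> 'a set" where
  "facet_collar i c = {x. \<bar>x \<bullet> i - c\<bar> < 1 \<and> (\<forall>b\<in>Basis - {i}. 0 < x \<bullet> b \<and> x \<bullet> b < 1)}"

definition inward_normal :: "'a::euclidean_space \<Rightarrow> real \<Rightarrow> 'a" where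
  "inward_normal i c = (1 - 2 * c) *\<^sub>R i"

lemma nonconstant_on_cube_facet:
  fixes g :: "'a::euclidean_space \<Rightarrow> 'b"
  assumes dim: "2 \<le> DIM('a)"
    and nonconst: "\<not> g constant_on frontier (cbox 0 (One :: 'a))"
  obtains i :: 'a and c where "i \<in> Basis" "c \<in> {0, 1}" "\<not> g constant_on cube_facet i c"
proof (rule ccontr)
  assume "\<not> thesis"
  with that have const: "g constant_on cube_facet i c" if "i \<in> Basis" "c \<in> {0, 1}" for i :: 'a and c
    using that by blast
  then have eq: "g x = g y"
    if "i \<in> Basis" "c \<in> {0, 1}" "x \<in> cube_facet i c" "y \<in> cube_facet i c" for x y i and c :: real
    using const[OF that(1,2)] that(3,4) unfolding constant_on_def by auto
  have "g x = g 0" if "x \<in> frontier (cbox 0 One)" for x :: 'a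
  proof -
    have x: "x \<in> cbox 0 One" and "x \<notin> box 0 One"
      using that by (simp_all add: frontier_cbox)
    then obtain i c where i: "i \<in> Basis" and c: "c \<in> {0, 1}" "x \<bullet> i = c"
      by (force simp: mem_box)
    have "card (Basis :: 'a set) \<noteq> card {i}"
      using dim by simp
    then have "(Basis :: 'a set) \<noteq> {i}"
      by (rule contrapos_nn) simp
    then obtain j where j: "j \<in> Basis" "j \<noteq> i"
      using i by blast
    define y where "y = x - (x \<bullet> j) *\<^sub>R j"
    have y: "y \<bullet> b = (if b = j then 0 else x \<bullet> b)" if "b \<in> Basis" for b
      using that j(1) by (simp add: y_def inner_diff_left inner_Basis)
    have "g x = g y"
      using x y i c j by (intro eq[of i c]) (simp_all add: cube_facet_def mem_box)
    also have "g y = g 0"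
      using x y j by (intro eq[of j 0]) (simp_all add: cube_facet_def mem_box)
    finally show ?thesis .
  qed
  then show False
    using nonconst unfolding constant_on_def by blast
qed

lemma integral_vector_inward_normal:
  "i \<in> Basis \<Longrightarrow> c \<in> {0, 1} \<Longrightarrow> integral_vector (inward_normal i c)"
  unfolding inward_normal_def by (intro integral_vector_scaleR integral_vector_Basis) auto

lemma inward_normal_eq_iff: "c \<in> {0, 1} \<Longrightarrow> inward_normal i c \<bullet> x = - c \<longleftrightarrow> x \<bullet> i = c"
  by (auto simp: inward_normal_def inner_commute)

lemma unit_cube_ge_inward_normal:
  "x \<in> cbox 0 One \<Longrightarrow> i \<in> Basis \<Longrightarrow> c \<in> {0, 1} \<Longrightarrow> - c \<le> inward_normal i c \<bullet> x"
  by (auto simp: inward_normal_def mem_box inner_commute[of i x])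

lemma facet_collar_eq:
  "facet_collar i c = {x. i \<bullet> x > c - 1} \<inter> {x. i \<bullet> x < c + 1} \<inter>
     (\<Inter>b\<in>Basis - {i}. {x. b \<bullet> x > 0} \<inter> {x. b \<bullet> x < 1})"
  by (auto simp: facet_collar_def inner_commute)

lemma open_facet_collar: "open (facet_collar i c)"
  unfolding facet_collar_eq
  by (intro open_Int open_INT ballI open_halfspace_gt open_halfspace_lt) simp

lemma convex_facet_collar: "convex (facet_collar i c)"
  unfolding facet_collar_eq by (intro convex_Int convex_INT convex_halfspace_gt convex_halfspace_lt)

lemma facet_collar_cube_iff:
  assumes "i \<in> Basis" "c \<in> {0, 1}" "x \<in> facet_collar i c"
  shows "x \<in> cbox 0 One \<longleftrightarrow> - c \<le> inward_normal i c \<bullet> x"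
proof -
  have "x \<in> cbox 0 One \<longleftrightarrow> 0 \<le> x \<bullet> i \<and> x \<bullet> i \<le> 1"
  proof
    assume x: "0 \<le> x \<bullet> i \<and> x \<bullet> i \<le> 1"
    have "0 \<le> x \<bullet> b \<and> x \<bullet> b \<le> 1" if "b \<in> Basis" for b
      using x assms(3) that by (cases "b = i") (auto simp: facet_collar_def less_imp_le)
    then show "x \<in> cbox 0 One"
      by (simp add: mem_box)
  qed (use assms(1) in \<open>simp add: mem_box\<close>)
  also have "\<dots> \<longleftrightarrow> - c \<le> inward_normal i c \<bullet> x"
    using assms(2,3) by (auto simp: inward_normal_def facet_collar_def inner_commute)
  finally show ?thesis .
qed

lemma hyperplane_Int_facet_collar:
  "c \<in> {0, 1} \<Longrightarrow> {x. inward_normal i c \<bullet> x = - c} \<inter> facet_collar i c = cube_facet_interior i c"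
  by (auto simp: cube_facet_interior_def facet_collar_def inward_normal_eq_iff)

lemma open_segment_from_facet_center:
  assumes i: "i \<in> Basis"
  shows "\<exists>m\<in>cube_facet_interior i c. \<forall>x\<in>cube_facet i c. open_segment m x \<subseteq> cube_facet_interior i c"
proof -
  define m where "m = (1 / 2) *\<^sub>R One + (c - 1 / 2) *\<^sub>R i"
  have m: "m \<bullet> b = (if b = i then c else 1 / 2)" if "b \<in> Basis" for b
    using that i by (simp add: m_def inner_add_left inner_Basis)
  have "m \<in> cube_facet_interior i c"
    using m i by (simp add: cube_facet_interior_def)
  moreover have "y \<in> cube_facet_interior i c" if x: "x \<in> cube_facet i c" and y: "y \<in> open_segment m x" for x y
  proof -
    obtain u where u: "0 < u" "u < 1" and y: "y = (1 - u) *\<^sub>R m + u *\<^sub>R x"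
      using y by (auto simp: in_segment)
    have "y \<bullet> i = c"
      using x m i by (simp add: y cube_facet_def inner_add_left algebra_simps)
    moreover have "0 < y \<bullet> b \<and> y \<bullet> b < 1" if b: "b \<in> Basis - {i}" for b
    proof -
      have "0 \<le> x \<bullet> b" "x \<bullet> b \<le> 1"
        using x b by (auto simp: cube_facet_def mem_box)
      moreover define s where "s = u * (x \<bullet> b)"
      ultimately have "0 \<le> s" "s \<le> u"
        using u by (simp_all add: mult_left_le)
      moreover have "y \<bullet> b = (1 - u) / 2 + s"
        using b m by (simp add: y s_def inner_add_left)
      ultimately show ?thesis
        using u by (simp add: field_simps)
    qed
    ultimately show ?thesis
      by (simp add: cube_facet_interior_def)
  qed
  ultimately show ?thesis
    by (intro bexI[of _ m] ballI subsetI)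
qed

lemma cube_facet_subset_closure_interior:
  assumes "i \<in> Basis"
  shows "cube_facet i c \<subseteq> closure (cube_facet_interior i c)"
proof
  fix x assume x: "x \<in> cube_facet i c"
  obtain m where m: "m \<in> cube_facet_interior i c" and segment: "\<forall>x\<in>cube_facet i c. open_segment m x \<subseteq> cube_facet_interior i c"
    using open_segment_from_facet_center[OF assms] ..
  show "x \<in> closure (cube_facet_interior i c)"
  proof (cases "m = x")
    case True
    then show ?thesis
      using subsetD[OF closure_subset m] by simp
  next
    case False
    then have "closed_segment m x \<subseteq> closure (cube_facet_interior i c)"
      using closure_mono[OF bspec[OF segment x]] by simp
    then show ?thesis
      by auto
  qed
qed

lemma nonconstant_affine_piece_at_facet:
  fixes g :: "'a::euclidean_space \<Rightarrow> real"
  assumes g: "Z_map g" and i: "i \<in> Basis" and c: "c \<in> {0, 1}"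
    and nonconst: "\<not> g constant_on cube_facet i c"
  obtains p e a d w where "p \<in> facet_collar i c" "p \<bullet> i = c" "e > 0" "integral_vector a"
    "\<And>x. x \<in> ball p e \<Longrightarrow> - c \<le> inward_normal i c \<bullet> x \<Longrightarrow> g x = a \<bullet> x + d"
    "inward_normal i c \<bullet> w = 0" "a \<bullet> w \<noteq> 0"
proof -
  note interior = hyperplane_Int_facet_collar[OF c, of i]
  have g_cont: "continuous_on S g" for S
    using g by (rule Z_map_continuous_on)
  obtain P where P: "finite P" "\<And>h. h \<in> P \<Longrightarrow> integral_vector (fst h)" "\<And>x. \<exists>h\<in>P. g x = affine_fun h x"
    using Z_map_affine_pieces[OF g] by blast
  have "\<not> g constant_on cube_facet_interior i c"
  proof
    assume "g constant_on cube_facet_interior i c"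
    then obtain y where y: "\<And>x. x \<in> cube_facet_interior i c \<Longrightarrow> g x = y"
      unfolding constant_on_def by blast
    have "g x = y" if "x \<in> cube_facet i c" for x
      by (rule continuous_constant_on_closure[OF g_cont y
            subsetD[OF cube_facet_subset_closure_interior[OF i] that]])
    then show False
      using nonconst unfolding constant_on_def by blast
  qed
  moreover have "connected (cube_facet_interior i c)"
    unfolding interior[symmetric] by (intro convex_connected convex_Int convex_hyperplane convex_facet_collar)
  moreover have "inward_normal i c \<noteq> 0"
    using i c by (auto simp: inward_normal_def)
  ultimately obtain p e h w where p: "p \<in> facet_collar i c" "inward_normal i c \<bullet> p = - c" "e > 0"
      and "h \<in> P" and aff: "\<And>x. x \<in> ball p e \<Longrightarrow> - c \<le> inward_normal i c \<bullet> x \<Longrightarrow> g x = affine_fun h x"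
      and w: "inward_normal i c \<bullet> w = 0" "fst h \<bullet> w \<noteq> 0"
    using nonconstant_affine_piece_beside_hyperplane[OF g_cont P(1,3) _ open_facet_collar,
        of "inward_normal i c" "- c" i c, unfolded interior] by blast
  show ?thesis
  proof (rule that[OF p(1) _ p(3) P(2)[OF \<open>h \<in> P\<close>] _ w])
    show "p \<bullet> i = c"
      using p(2) by (simp add: inward_normal_eq_iff[OF c])
    show "g x = fst h \<bullet> x + snd h" if "x \<in> ball p e" "- c \<le> inward_normal i c \<bullet> x" for x
      using aff[OF that] by (simp add: affine_fun_def)
  qed
qed

lemma Z_map_absorbing_shift_at_facet:
  fixes p v w :: "'a::euclidean_space"
  assumes i: "i \<in> Basis" and c: "c \<in> {0, 1}" and U: "open U" "p \<in> U" and p: "p \<bullet> i = c"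
    and v: "integral_vector v" "inward_normal i c \<bullet> v > 0"
    and w: "w \<noteq> 0" "inward_normal i c \<bullet> w = 0"
  obtains t where "Z_map t" "\<And>x. t x \<ge> 0" "\<And>x. t (x + t x *\<^sub>R v) = 0"
    "\<And>x. - c \<le> inward_normal i c \<bullet> x \<Longrightarrow> t x > 0 \<Longrightarrow> x \<in> U \<and> x + t x *\<^sub>R v \<in> U"
    "\<exists>y. inward_normal i c \<bullet> y = - c \<and> t y > 0"
proof -
  have "c \<in> \<int>"
    using c by auto
  obtain r and m :: int where r: "r \<in> U" "m > 0" "integral_vector (of_int m *\<^sub>R r)"
      and r_eq: "\<And>b. b \<in> Basis \<Longrightarrow> p \<bullet> b \<in> \<int> \<Longrightarrow> r \<bullet> b = p \<bullet> b"
    using rational_point_near[OF U] by blast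
  then have nr: "inward_normal i c \<bullet> r = - c"
    using r_eq[OF i] c p \<open>c \<in> \<int>\<close> by (simp add: inward_normal_eq_iff)
  obtain \<delta> where \<delta>: "\<delta> > 0" "ball r \<delta> \<subseteq> U"
    using U(1) r(1) open_contains_ball by metis
  have "inward_normal i c \<bullet> r \<in> \<int>"
    using \<open>c \<in> \<int>\<close> by (simp add: nr)
  note shift = Z_map_absorbing_shift[OF integral_vector_inward_normal[OF i c] this v r(2,3) w \<delta>(1),
    unfolded nr]
  obtain t where t: "Z_map t" "\<And>x. t x \<ge> 0" "\<And>x. t (x + t x *\<^sub>R v) = 0"
      and near: "\<And>x. - c \<le> inward_normal i c \<bullet> x \<Longrightarrow> t x > 0 \<Longrightarrow>
        x \<in> ball r \<delta> \<and> x + t x *\<^sub>R v \<in> ball r \<delta>"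
      and pos: "\<exists>y. inward_normal i c \<bullet> y = - c \<and> t y > 0"
    using shift by blast
  have "x \<in> U \<and> x + t x *\<^sub>R v \<in> U" if "- c \<le> inward_normal i c \<bullet> x" "t x > 0" for x
    using near[OF that] \<delta>(2) by blast
  then show ?thesis
    by (rule that[OF t _ pos])
qed

section \<open>Factoring maps through the cube\<close>

lemma Z_map_absorbing_shift_of_cube:
  fixes p v w :: "'a::euclidean_space"
  assumes i: "i \<in> Basis" and c: "c \<in> {0, 1}"
    and U: "open U" "p \<in> U" and p: "p \<in> facet_collar i c" "p \<bullet> i = c"
    and v: "integral_vector v" "inward_normal i c \<bullet> v > 0"
    and w: "w \<noteq> 0" "inward_normal i c \<bullet> w = 0"
  obtains t where "Z_map t" "\<And>x. t (x + t x *\<^sub>R v) = 0"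
    "\<And>x. x \<in> cbox 0 One \<Longrightarrow> x + t x *\<^sub>R v \<in> cbox 0 One"
    "\<And>x. x \<in> cbox 0 One \<Longrightarrow> t x \<noteq> 0 \<Longrightarrow> x \<in> U \<and> x + t x *\<^sub>R v \<in> U"
    "\<exists>y\<in>cbox 0 One. t y > 0"
proof -
  have "open (U \<inter> facet_collar i c)" "p \<in> U \<inter> facet_collar i c"
    using U p(1) by (simp_all add: open_Int open_facet_collar)
  then obtain t where t: "Z_map t" "\<And>x. t x \<ge> 0" "\<And>x. t (x + t x *\<^sub>R v) = 0"
    and near: "\<And>x. - c \<le> inward_normal i c \<bullet> x \<Longrightarrow> t x > 0 \<Longrightarrow>
      x \<in> U \<inter> facet_collar i c \<and> x + t x *\<^sub>R v \<in> U \<inter> facet_collar i c"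
    and pos: "\<exists>y. inward_normal i c \<bullet> y = - c \<and> t y > 0"
    using Z_map_absorbing_shift_at_facet[OF i c _ _ p(2) v w] by blast
  have cube: "- c \<le> inward_normal i c \<bullet> x" if "x \<in> cbox 0 One" for x
    using that i c by (rule unit_cube_ge_inward_normal)
  show ?thesis
  proof (rule that[OF t(1,3)])
    fix x :: 'a assume x: "x \<in> cbox 0 One"
    show "x \<in> U \<and> x + t x *\<^sub>R v \<in> U" if "t x \<noteq> 0"
      using near[OF cube[OF x]] t(2)[of x] that by simp
    show "x + t x *\<^sub>R v \<in> cbox 0 One"
    proof (cases "t x = 0")
      case False
      then have "x + t x *\<^sub>R v \<in> facet_collar i c"
        using near[OF cube[OF x]] t(2)[of x] by simp
      moreover have "- c \<le> inward_normal i c \<bullet> (x + t x *\<^sub>R v)"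
        using cube[OF x] mult_nonneg_nonneg[OF t(2)[of x], of "inward_normal i c \<bullet> v"] v(2)
        by (simp add: inner_add_right)
      ultimately show ?thesis
        using facet_collar_cube_iff[OF i c] by blast
    qed (use x in simp)
  next
    obtain y where "inward_normal i c \<bullet> y = - c" "t y > 0"
      using pos by blast
    then show "\<exists>y\<in>cbox 0 One. t y > 0"
      using near[of y] facet_collar_cube_iff[OF i c, of y] by auto
  qed
qed

lemma Z_map_invariant_under_absorbing_shift:
  fixes g :: "'a::euclidean_space \<Rightarrow> real"
  assumes g: "Z_map g" and i: "i \<in> Basis" and c: "c \<in> {0, 1}"
    and nonconst: "\<not> g constant_on cube_facet i c"
  obtains t v where "Z_map t" "integral_vector v" "\<And>x. t (x + t x *\<^sub>R v) = 0"
    "\<And>x. x \<in> cbox 0 One \<Longrightarrow> x + t x *\<^sub>R v \<in> cbox 0 One"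
    "\<And>x. x \<in> cbox 0 One \<Longrightarrow> g (x + t x *\<^sub>R v) = g x"
    "\<exists>y\<in>cbox 0 One. t y > 0"
proof -
  obtain p e a d w where p: "p \<in> facet_collar i c" "p \<bullet> i = c" and e: "e > 0" and a: "integral_vector a"
    and aff: "\<And>x. x \<in> ball p e \<Longrightarrow> - c \<le> inward_normal i c \<bullet> x \<Longrightarrow> g x = a \<bullet> x + d"
    and w: "inward_normal i c \<bullet> w = 0" "a \<bullet> w \<noteq> 0"
    using nonconstant_affine_piece_at_facet[OF assms] by blast
  have n: "integral_vector (inward_normal i c)" "inward_normal i c \<noteq> 0"
    using i c integral_vector_inward_normal[OF i c] by (auto simp: inward_normal_def)
  obtain v where v: "integral_vector v" "a \<bullet> v = 0" "inward_normal i c \<bullet> v > 0"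
    using integral_vector_orthogonal_inward[OF a n w] by blast
  have "p \<in> ball p e" "w \<noteq> 0"
    using e w(2) by auto
  then obtain t where t: "Z_map t" "\<And>x. t (x + t x *\<^sub>R v) = 0"
    and cube: "\<And>x. x \<in> cbox 0 One \<Longrightarrow> x + t x *\<^sub>R v \<in> cbox 0 One"
    and near: "\<And>x. x \<in> cbox 0 One \<Longrightarrow> t x \<noteq> 0 \<Longrightarrow> x \<in> ball p e \<and> x + t x *\<^sub>R v \<in> ball p e"
    and pos: "\<exists>y\<in>cbox 0 One. t y > 0"
    using Z_map_absorbing_shift_of_cube[OF i c open_ball _ p v(1,3) _ w(1)] by blast
  have aff_cube: "g x = a \<bullet> x + d" if "x \<in> cbox 0 One" "x \<in> ball p e" for x
    using that(2) unit_cube_ge_inward_normal[OF that(1) i c] by (rule aff)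
  have "g (x + t x *\<^sub>R v) = g x" if x: "x \<in> cbox 0 One" for x
  proof (cases "t x = 0")
    case False
    have "g (x + t x *\<^sub>R v) = a \<bullet> (x + t x *\<^sub>R v) + d"
      using near[OF x False] by (intro aff_cube cube x) simp
    also have "\<dots> = a \<bullet> x + d"
      using v(2) by (simp add: inner_add_right)
    also have "\<dots> = g x"
      using near[OF x False] x by (simp add: aff_cube)
    finally show ?thesis .
  qed simp
  then show ?thesis
    using that[OF t(1) v(1) t(2) cube _ pos] by blast
qed

lemma connected_perturbation_attains:
  fixes g t :: "'a::topological_space \<Rightarrow> real"
  assumes S: "connected S" "continuous_on S g" "continuous_on S t"
    and x: "x \<in> S" "t x = 0" and y: "y \<in> S" "t y > 0"
  obtains K :: int where "z \<in> (\<lambda>u. g u + of_int K * t u) ` S"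
proof -
  have image: "connected ((\<lambda>u. g u + of_int K * t u) ` S)" for K :: int
    using S by (intro connected_continuous_image continuous_intros)
  have mem: "g x \<in> (\<lambda>u. g u + of_int K * t u) ` S"
      "g y + of_int K * t y \<in> (\<lambda>u. g u + of_int K * t u) ` S" for K :: int
    using x y(1) by (auto intro!: image_eqI[of "g x" _ x])
  show ?thesis
  proof (cases "g x \<le> z")
    case True
    obtain K :: int where "(z - g y) / t y < of_int K"
      using ex_less_of_int by blast
    then have "z \<le> g y + of_int K * t y"
      using y(2) by (simp add: field_simps)
    then show ?thesis
      using that[of K] connectedD_interval[OF image mem True] by blast
  next
    case False
    obtain K :: int where "of_int K < (z - g y) / t y"
      using ex_of_int_less by blast
    then have "g y + of_int K * t y \<le> z"
      using y(2) by (simp add: field_simps)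
    then show ?thesis
      using that[of K] connectedD_interval[OF image mem(2,1)] False by (meson linear)
  qed
qed

lemma Z_map_factorization_attaining_value:
  fixes g :: "'a::euclidean_space \<Rightarrow> real" and z :: real
  assumes dim: "2 \<le> DIM('a)" and g: "Z_map g" and nonconst: "\<not> g constant_on frontier (cbox 0 One)"
  obtains \<theta> and \<alpha> :: "'a \<Rightarrow> 'a" where "Z_map \<theta>" "Z_map \<alpha>" "\<alpha> ` cbox 0 One \<subseteq> cbox 0 One" "z \<in> \<theta> ` cbox 0 One"
    "\<forall>x\<in>cbox 0 One. \<theta> (\<alpha> x) = g x"
proof -
  obtain i :: 'a and c where facet: "i \<in> Basis" "c \<in> {0, 1}" "\<not> g constant_on cube_facet i c"
    using nonconstant_on_cube_facet[OF dim nonconst] by blast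
  obtain t v where t: "Z_map t" and v: "integral_vector v" and absorb: "\<And>x. t (x + t x *\<^sub>R v) = 0"
    and cube: "\<And>x. x \<in> cbox 0 One \<Longrightarrow> x + t x *\<^sub>R v \<in> cbox 0 One"
    and invariant: "\<And>x. x \<in> cbox 0 One \<Longrightarrow> g (x + t x *\<^sub>R v) = g x"
    and pos: "\<exists>y\<in>cbox 0 One. t y > 0"
    using Z_map_invariant_under_absorbing_shift[OF g facet] by blast
  obtain y where y: "y \<in> cbox 0 One" "t y > 0"
    using pos by blast
  obtain K :: int where K: "z \<in> (\<lambda>x. g x + of_int K * t x) ` cbox 0 One"
    using connected_perturbation_attains[OF convex_connected[OF convex_box(1)]
        Z_map_continuous_on[OF g] Z_map_continuous_on[OF t] cube[OF y(1)] absorb y] by blast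
  show ?thesis
  proof (rule that[of "\<lambda>x. g x + of_int K * t x" "\<lambda>x. x + t x *\<^sub>R v"])
    show "Z_map (\<lambda>x. g x + of_int K * t x)"
      using g t by (intro Z_map_add Z_map_cmult) simp_all
    show "Z_map (\<lambda>x. x + t x *\<^sub>R v)"
      using t v by (rule Z_map_shift)
    show "(\<lambda>x. x + t x *\<^sub>R v) ` cbox 0 One \<subseteq> cbox 0 One"
      using cube by blast
    show "\<forall>x\<in>cbox 0 One. g (x + t x *\<^sub>R v) + of_int K * t (x + t x *\<^sub>R v) = g x"
      using invariant absorb by simp
  qed (rule K)
qed

theorem theorem4p7:
  fixes \<eta> :: "real ^ 'n \<Rightarrow> real" and z :: int
  assumes "CARD('n) \<ge> 2"
    and "Z_map_on unit_cube UNIV \<eta>"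
    and "\<not> \<eta> constant_on frontier unit_cube"
  shows "\<exists>(\<theta> :: real ^ 'n \<Rightarrow> real) (\<alpha> :: real ^ 'n \<Rightarrow> real ^ 'n).
           Z_map_on unit_cube UNIV \<theta> \<and>
           Z_map_on unit_cube unit_cube \<alpha> \<and>
           of_int z \<in> \<theta> ` unit_cube \<and>
           (\<forall>x\<in>unit_cube. \<theta> (\<alpha> x) = \<eta> x)"
proof -
  obtain g where g: "Z_map g" and \<eta>: "\<And>x. x \<in> unit_cube \<Longrightarrow> \<eta> x = g x"
    using assms(2) unfolding Z_map_on_def by blast
  have nonconst: "\<not> g constant_on frontier unit_cube"
    using assms(3) \<eta> unfolding constant_on_def frontier_cbox by auto
  have dim: "2 \<le> DIM(real ^ 'n)"
    using assms(1) by simp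
  obtain \<theta> and \<alpha> :: "real ^ 'n \<Rightarrow> real ^ 'n" where Z_map: "Z_map \<theta>" "Z_map \<alpha>"
      and \<alpha>: "\<alpha> ` unit_cube \<subseteq> unit_cube"
      and z: "of_int z \<in> \<theta> ` unit_cube" and factor: "\<forall>x\<in>unit_cube. \<theta> (\<alpha> x) = g x"
    using Z_map_factorization_attaining_value[where z = "of_int z",
        OF dim g nonconst[unfolded Cart_1], folded Cart_1] by blast
  have "Z_map_on unit_cube UNIV \<theta>" "Z_map_on unit_cube unit_cube \<alpha>"
    using Z_map \<alpha> unfolding Z_map_on_def by blast+
  moreover have "\<forall>x\<in>unit_cube. \<theta> (\<alpha> x) = \<eta> x"
    using factor \<eta> by simp
  ultimately show ?thesis
    using z by (intro exI[of _ \<theta>] exI[of _ \<alpha>] conjI)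
qed

end
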